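(* The derangement Eulerian numbers $d(n,k)$, viewed for each $n\ge2$ as the distribution $k\mapsto d(n,k)/d(n)$ on $\mathbb{Z}$, obey a Gaussian local limit law with mean $\mu_d(n)=n/2$ and variance $\sigma_d(n)^2\sim n/12$. That is, with $k(n,x)=\lfloor n/2+x\sigma_d(n)\rfloor$, we have $\lim_{n\to\infty}\sigma_d(n)\,d(n,k(n,x))/d(n)=\frac{1}{\sqrt{2\pi}}e^{-x^2/2}$ uniformly in $x\in\mathbb{R}$.
   Context: An excedance of $\pi\in S_n$ is an $i\in[n]$ with $\pi(i)>i$. A derangement is a permutation with no fixed points. $d(n,k)$ is the number of derangements in $S_n$ with exactly $k$ excedances, $d(n)=\sum_kd(n,k)$ is the number of derangements in $S_n$, and $\sigma_d(n)$ is the standard deviation of the distribution $k\mapsto d(n,k)/d(n)$. *)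

theory Defs
  imports "HOL-Probability.Probability" "HOL-Combinatorics.Permutations"
begin

definition excedances :: "nat \<Rightarrow> (nat \<Rightarrow> nat) \<Rightarrow> nat set" where
  "excedances n p = {i \<in> {1..n}. p i > i}"

definition derangements :: "nat \<Rightarrow> (nat \<Rightarrow> nat) set" where
  "derangements n = {p. p permutes {1..n} \<and> (\<forall>i\<in>{1..n}. p i \<noteq> i)}"

text \<open>The second argument is an integer, since the index \<open>\<lfloor>n/2 + x \<sigma>\<rfloor>\<close> may be negative.\<close>

definition derangement_eulerian :: "nat \<Rightarrow> int \<Rightarrow> nat" where
  "derangement_eulerian n k = card {p \<in> derangements n. int (card (excedances n p)) = k}"

definition derangement_number :: "nat \<Rightarrow> nat" where
  "derangement_number n = card (derangements n)"

text \<open>The probability distribution \<open>k \<mapsto> d(n,k)/d(n)\<close>. It is meaningful only for \<open>n \<noteq> 1\<close>;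
  lemma \<open>pmf_derangement_pmf\<close> below discharges the side conditions for \<open>n \<ge> 2\<close>.\<close>

definition derangement_pmf :: "nat \<Rightarrow> int pmf" where
  "derangement_pmf n =
     embed_pmf (\<lambda>k. real (derangement_eulerian n k) / real (derangement_number n))"

definition derangement_mean :: "nat \<Rightarrow> real" where
  "derangement_mean n = measure_pmf.expectation (derangement_pmf n) real_of_int"

definition derangement_sd :: "nat \<Rightarrow> real" where
  "derangement_sd n = sqrt (measure_pmf.variance (derangement_pmf n) real_of_int)"

definition derangement_index :: "nat \<Rightarrow> real \<Rightarrow> int" where
  "derangement_index n x = \<lfloor>real n / 2 + x * derangement_sd n\<rfloor>"

lemma finite_derangements: "finite (derangements n)"
  by (rule finite_subset[OF _ finite_permutations[of "{1..n}"]]) (auto simp: derangements_def)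

lemma card_excedances_le: "card (excedances n p) \<le> n"
proof -
  have "card (excedances n p) \<le> card {1..n}"
    by (rule card_mono) (auto simp: excedances_def)
  then show ?thesis by simp
qed

lemma derangement_eulerian_eq_0:
  assumes "k \<notin> {0..int n}"
  shows "derangement_eulerian n k = 0"
proof -
  have "int (card (excedances n p)) \<noteq> k" for p
    using assms card_excedances_le[of n p] by auto
  then show ?thesis by (simp add: derangement_eulerian_def)
qed

lemma derangement_number_eq_sum:
  "derangement_number n = (\<Sum>k\<in>{0..int n}. derangement_eulerian n k)"
proof -
  have "(\<Sum>k\<in>{0..int n}. \<Sum>p\<in>{p \<in> derangements n. int (card (excedances n p)) = k}. 1)
      = (\<Sum>p\<in>derangements n. 1::nat)"
    by (rule sum.group) (use card_excedances_le in \<open>auto simp: finite_derangements\<close>)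
  then show ?thesis
    by (simp add: derangement_number_def derangement_eulerian_def)
qed

lemma derangement_number_pos:
  assumes "n \<ge> 2"
  shows "derangement_number n > 0"
proof -
  define p where "p i = (if i \<in> {1..n} then if i = n then 1 else Suc i else i)" for i
  have "p permutes {1..n}"
  proof (rule inj_imp_permutes)
    show "inj_on p {1..n}"
      by (auto simp: p_def inj_on_def split: if_splits)
  qed (use assms in \<open>auto simp: p_def\<close>)
  moreover have "p i \<noteq> i" if "i \<in> {1..n}" for i
    using that assms by (auto simp: p_def)
  ultimately have "p \<in> derangements n"
    by (auto simp: derangements_def)
  then show ?thesis
    using finite_derangements by (auto simp: derangement_number_def card_gt_0_iff)
qed

lemma pmf_derangement_pmf:
  assumes "n \<ge> 2"
  shows "pmf (derangement_pmf n) k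
    = real (derangement_eulerian n k) / real (derangement_number n)"
  unfolding derangement_pmf_def
proof (rule pmf_embed_pmf)
  let ?f = "\<lambda>k. real (derangement_eulerian n k) / real (derangement_number n)"
  have "(\<integral>\<^sup>+k. ennreal (?f k) \<partial>count_space UNIV) = (\<Sum>k\<in>{0..int n}. ennreal (?f k))"
    by (rule nn_integral_count_space') (auto simp: derangement_eulerian_eq_0)
  also have "\<dots> = ennreal (\<Sum>k\<in>{0..int n}. ?f k)"
    by (rule sum_ennreal) auto
  also have "(\<Sum>k\<in>{0..int n}. ?f k) = real (derangement_number n) / real (derangement_number n)"
    by (simp only: derangement_number_eq_sum of_nat_sum sum_divide_distrib)
  also have "\<dots> = 1"
    using derangement_number_pos[OF assms] by simp
  finally show "(\<integral>\<^sup>+k. ennreal (?f k) \<partial>count_space UNIV) = 1"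
    by simp
qed auto

end

theory Submission
  imports Defs "HOL-Computational_Algebra.Fundamental_Theorem_Algebra"
begin

text \<open>
  Inserting \<open>n + 1\<close> into the cycles of a permutation of \<open>[n]\<close> gives a recurrence for the joint
  distribution of fixed points and excedances, and from it
  \<open>d\<^sub>n\<^sub>+\<^sub>1(t) = n t (d\<^sub>n(t) + d\<^sub>n\<^sub>-\<^sub>1(t)) + t (1 - t) d\<^sub>n'(t)\<close> for the derangement polynomials. The recurrence
  yields mean \<open>n/2\<close> and an exact variance. It also preserves the statement that, for \<open>z\<close> in the upper
  half plane, \<open>d\<^sub>n(z) \<noteq> 0\<close>, \<open>Im (d\<^sub>n\<^sub>-\<^sub>1(z) / d\<^sub>n(z)) \<le> 0\<close> and \<open>Im (z d\<^sub>n\<^sub>-\<^sub>1(z) / d\<^sub>n(z)) \<ge> 0\<close> (this encodes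
  interlacing), so \<open>d\<^sub>n\<close> has only real, nonpositive roots. Hence the normalized characteristic function
  is a product of Bernoulli factors; it is dominated by \<open>exp (- s\<^sup>2/18)\<close> on the full period
  \<open>|s| \<le> \<pi> \<sigma>\<close> and tends to \<open>exp (- s\<^sup>2/2)\<close> pointwise because \<open>\<sigma> \<rightarrow> \<infinity>\<close>. Fourier inversion and dominated
  convergence give the limit, uniformly in the lattice point.
\<close>

section \<open>The insertion recurrence\<close>

definition fixed_points :: "nat \<Rightarrow> (nat \<Rightarrow> nat) \<Rightarrow> nat set" where
  "fixed_points n p = {i \<in> {1..n}. p i = i}"

text \<open>The joint law is kept as a functional on arbitrary weights \<open>F\<close> over any
  commutative ring, so that one recurrence serves counting, real moments and complex polynomials
  alike.\<close>

definition perm_sum :: "nat \<Rightarrow> (nat \<Rightarrow> nat \<Rightarrow> 'a) \<Rightarrow> 'a::comm_ring_1" where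
  "perm_sum n F = (\<Sum>p | p permutes {1..n}. F (card (fixed_points n p)) (card (excedances n p)))"

definition derangement_sum :: "nat \<Rightarrow> (nat \<Rightarrow> 'a) \<Rightarrow> 'a::comm_ring_1" where
  "derangement_sum n h = (\<Sum>p\<in>derangements n. h (card (excedances n p)))"

lemma finite_fixed_points [simp]: "finite (fixed_points n p)"
  and finite_excedances [simp]: "finite (excedances n p)"
  by (auto simp: fixed_points_def excedances_def)

context
  fixes n :: nat and q :: "nat \<Rightarrow> nat"
  assumes q: "q permutes {1..n}"
begin

lemma permutes_Suc_eq: "q (Suc n) = Suc n"
  using q by (rule permutes_not_in) auto

text \<open>Composing with this transposition places \<open>Suc n\<close> between \<open>a\<close>
  and \<open>q a\<close> in the cycle of \<open>a\<close>.\<close>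

lemma insertion_apply:
  assumes "a \<in> {1..n}"
  shows "(Transposition.transpose (Suc n) (q a) \<circ> q) i =
    (if i = a then Suc n else if i = Suc n then q a else q i)"
proof -
  have "q i = q a \<longleftrightarrow> i = a" for i
    using permutes_inj[OF q] by (auto dest: injD)
  moreover have "q i = Suc n \<longleftrightarrow> i = Suc n" for i
    using permutes_inj[OF q] permutes_Suc_eq by (metis injD)
  moreover have "a \<noteq> Suc n" using assms by auto
  ultimately show ?thesis
    by (cases "i = Suc n") (simp_all add: transpose_def permutes_Suc_eq)
qed

lemma fixed_points_Suc: "fixed_points (Suc n) q = insert (Suc n) (fixed_points n q)"
  using permutes_Suc_eq by (auto simp: fixed_points_def le_Suc_eq)

lemma excedances_Suc: "excedances (Suc n) q = excedances n q"
  using permutes_Suc_eq by (auto simp: excedances_def le_Suc_eq)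

lemma fixed_points_insertion:
  assumes "a \<in> {1..n}"
  shows "fixed_points (Suc n) (Transposition.transpose (Suc n) (q a) \<circ> q) = fixed_points n q - {a}"
proof -
  have "q a \<noteq> Suc n"
    using permutes_in_image[OF q, of a] assms by auto
  then show ?thesis
    using assms unfolding fixed_points_def insertion_apply[OF assms] by (auto simp: le_Suc_eq)
qed

text \<open>The point \<open>a\<close> now maps to \<open>Suc n\<close> and becomes an excedance,
  whereas \<open>Suc n\<close> itself maps downwards.\<close>

lemma excedances_insertion:
  assumes "a \<in> {1..n}"
  shows "excedances (Suc n) (Transposition.transpose (Suc n) (q a) \<circ> q) = insert a (excedances n q)"
proof -
  have "q a \<le> n"
    using permutes_in_image[OF q, of a] assms by auto
  then show ?thesis
    using assms unfolding excedances_def insertion_apply[OF assms] by (auto simp: le_Suc_eq)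
qed

end

text \<open>Insertion in adjoint form, acting on weights instead of permutations. The four terms
  correspond to \<open>n + 1\<close> becoming a fixed point, or following a fixed point, an
  excedance, or one of the remaining points. Truncation in \<open>f - 1\<close> is harmless because
  the coefficient vanishes at \<open>f = 0\<close>.\<close>

definition insertion_step :: "nat \<Rightarrow> (nat \<Rightarrow> nat \<Rightarrow> 'a) \<Rightarrow> nat \<Rightarrow> nat \<Rightarrow> 'a::comm_ring_1" where
  "insertion_step n F f k = F (Suc f) k + of_nat f * F (f - 1) (Suc k)
     + of_nat k * F f k + (of_nat n - of_nat f - of_nat k) * F f (Suc k)"

text \<open>Each permutation of \<open>{1..Suc n}\<close> arises exactly once from some
  \<open>q\<close> on \<open>{1..n}\<close> and some \<open>b\<close> in \<open>{1..Suc n}\<close>;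
  the choice \<open>b = Suc n\<close> leaves \<open>q\<close> unchanged and makes the new point
  fixed.\<close>

lemma perm_sum_Suc: "perm_sum (Suc n) F = perm_sum n (insertion_step n F)"
proof -
  let ?f = "\<lambda>n p. card (fixed_points n p)" and ?e = "\<lambda>n p. card (excedances n p)"
  have *: "F (?f (Suc n) q) (?e (Suc n) q)
      + (\<Sum>b=1..n. F (?f (Suc n) (Transposition.transpose (Suc n) b \<circ> q)) (?e (Suc n) (Transposition.transpose (Suc n) b \<circ> q)))
      = insertion_step n F (?f n q) (?e n q)" if q: "q permutes {1..n}" for q
  proof -
    let ?W = "{i \<in> {1..n}. q i < i}"
    let ?g = "\<lambda>a. F (card (fixed_points n q - {a})) (card (insert a (excedances n q)))"
    have split: "{1..n} = fixed_points n q \<union> excedances n q \<union> ?W"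
      and disj: "fixed_points n q \<inter> excedances n q = {}" "(fixed_points n q \<union> excedances n q) \<inter> ?W = {}"
      by (auto simp: fixed_points_def excedances_def)
    have "card {1..n} = ?f n q + ?e n q + card ?W"
      using disj by (subst split) (simp add: card_Un_disjoint)
    then have W: "(of_nat (card ?W) :: 'a) = of_nat n - of_nat (?f n q) - of_nat (?e n q)"
      by (simp add: algebra_simps flip: of_nat_add)
    \<comment> \<open>Parametrize \<open>b\<close> as \<open>q a\<close>, so that
      \<open>Suc n\<close> is inserted right after \<open>a\<close>, then sort the points
      \<open>a\<close> by type.\<close>
    have "(\<Sum>b=1..n. F (?f (Suc n) (Transposition.transpose (Suc n) b \<circ> q)) (?e (Suc n) (Transposition.transpose (Suc n) b \<circ> q)))
        = (\<Sum>a=1..n. ?g a)"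
      using fixed_points_insertion[OF q] excedances_insertion[OF q]
      by (subst sum.reindex_bij_betw[OF permutes_imp_bij[OF q], symmetric]) simp
    also have "\<dots> = (\<Sum>a\<in>fixed_points n q. ?g a) + (\<Sum>a\<in>excedances n q. ?g a) + (\<Sum>a\<in>?W. ?g a)"
      using disj by (subst split) (simp add: sum.union_disjoint)
    also have "(\<Sum>a\<in>fixed_points n q. ?g a) = (\<Sum>a\<in>fixed_points n q. F (?f n q - 1) (Suc (?e n q)))"
      using disj by (intro sum.cong refl arg_cong2[where f = F])
        (auto simp: card_Diff_singleton intro!: card_insert_disjoint)
    also have "(\<Sum>a\<in>excedances n q. ?g a) = (\<Sum>a\<in>excedances n q. F (?f n q) (?e n q))"
      using disj by (intro sum.cong refl arg_cong2[where f = F] arg_cong[where f = card])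
        (auto simp: insert_absorb)
    also have "(\<Sum>a\<in>?W. ?g a) = (\<Sum>a\<in>?W. F (?f n q) (Suc (?e n q)))"
      using disj by (intro sum.cong refl) (auto simp: fixed_points_def excedances_def)
    finally have S: "(\<Sum>b=1..n. F (?f (Suc n) (Transposition.transpose (Suc n) b \<circ> q))
          (?e (Suc n) (Transposition.transpose (Suc n) b \<circ> q)))
        = of_nat (?f n q) * F (?f n q - 1) (Suc (?e n q)) + of_nat (?e n q) * F (?f n q) (?e n q)
          + of_nat (card ?W) * F (?f n q) (Suc (?e n q))"
      by (simp only: sum_constant)
    have "?f (Suc n) q = Suc (?f n q)"
      unfolding fixed_points_Suc[OF q] by (rule card_insert_disjoint) (auto simp: fixed_points_def)
    then show ?thesis
      unfolding S W insertion_step_def excedances_Suc[OF q] by (simp only: add.assoc)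
  qed
  have "{1..Suc n} = insert (Suc n) {1..n}" by auto
  then have "perm_sum (Suc n) F = (\<Sum>b\<in>insert (Suc n) {1..n}. \<Sum>q | q permutes {1..n}.
      F (?f (Suc n) (Transposition.transpose (Suc n) b \<circ> q)) (?e (Suc n) (Transposition.transpose (Suc n) b \<circ> q)))"
    unfolding perm_sum_def by (simp add: sum_over_permutations_insert)
  also have "\<dots> = (\<Sum>q | q permutes {1..n}. \<Sum>b\<in>insert (Suc n) {1..n}.
      F (?f (Suc n) (Transposition.transpose (Suc n) b \<circ> q)) (?e (Suc n) (Transposition.transpose (Suc n) b \<circ> q)))"
    by (rule sum.swap)
  also have "\<dots> = perm_sum n (insertion_step n F)"
    unfolding perm_sum_def by (intro sum.cong refl, subst *[symmetric]) auto
  finally show ?thesis .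
qed

section \<open>Marked fixed points and the derangement recurrence\<close>

lemma perm_sum_add: "perm_sum n (\<lambda>f k. F f k + G f k) = perm_sum n F + perm_sum n G"
  by (simp add: perm_sum_def sum.distrib)

text \<open>Deleting a marked fixed point; relabelling the remaining points is avoided by inducting
  along the insertion recurrence instead.\<close>

lemma perm_sum_marked_fixed_point:
  "perm_sum (Suc n) (\<lambda>f k. of_nat f * G (f - 1) k) = of_nat (Suc n) * perm_sum n G"
proof (induction n arbitrary: G)
  case 0
  then show ?case
    by (simp add: perm_sum_Suc) (simp add: perm_sum_def insertion_step_def fixed_points_def excedances_def)
next
  case (Suc n)
  \<comment> \<open>Either the marked fixed point is the new one, giving \<open>G f k\<close>, or it
    is one of the \<open>f\<close> old ones and must survive; the insertion then acts on the other
    points, hence size \<open>n\<close> and argument \<open>f - 1\<close>.\<close>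
  have "insertion_step (Suc n) (\<lambda>f k. of_nat f * G (f - 1) k) f k
      = G f k + of_nat f * insertion_step n G (f - 1) k" for f k
    by (cases f) (auto simp: insertion_step_def algebra_simps)
  then have "insertion_step (Suc n) (\<lambda>f k. of_nat f * G (f - 1) k)
      = (\<lambda>f k. G f k + of_nat f * insertion_step n G (f - 1) k)"
    by (intro ext)
  then have "perm_sum (Suc (Suc n)) (\<lambda>f k. of_nat f * G (f - 1) k)
      = perm_sum (Suc n) G + perm_sum (Suc n) (\<lambda>f k. of_nat f * insertion_step n G (f - 1) k)"
    by (simp only: perm_sum_Suc[of "Suc n"] perm_sum_add)
  also have "\<dots> = of_nat (Suc (Suc n)) * perm_sum (Suc n) G"
    unfolding Suc perm_sum_Suc[symmetric] by (simp add: algebra_simps)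
  finally show ?case .
qed

lemma derangement_sum_eq_perm_sum:
  "derangement_sum n h = perm_sum n (\<lambda>f k. if f = 0 then h k else 0)"
proof -
  have "derangements n = {p. p permutes {1..n}} \<inter> {p. card (fixed_points n p) = 0}"
    by (auto simp: derangements_def fixed_points_def)
  then show ?thesis
    by (simp add: derangement_sum_def perm_sum_def sum.inter_restrict finite_permutations)
qed

text \<open>A derangement of \<open>n + 2\<close> points that arises by insertion comes from a
  permutation of \<open>n + 1\<close> points with no fixed point, or with exactly one that the
  insertion destroys. In the latter case the coefficient \<open>of_nat f\<close> lets that point
  count as marked, so it can be deleted.\<close>

lemma derangement_sum_Suc_Suc:
  "derangement_sum (Suc (Suc n)) h = of_nat (Suc n) * derangement_sum n (\<lambda>k. h (Suc k))
     + derangement_sum (Suc n) (\<lambda>k. of_nat k * h k + (of_nat (Suc n) - of_nat k) * h (Suc k))"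
proof -
  have "insertion_step (Suc n) (\<lambda>f k. if f = 0 then h k else 0) f k =
      of_nat f * (if f - 1 = 0 then h (Suc k) else 0) +
      (if f = 0 then of_nat k * h k + (of_nat (Suc n) - of_nat k) * h (Suc k) else 0)" for f k
    by (auto simp: insertion_step_def)
  then have "insertion_step (Suc n) (\<lambda>f k. if f = 0 then h k else 0) = (\<lambda>f k.
      of_nat f * (if f - 1 = 0 then h (Suc k) else 0) +
      (if f = 0 then of_nat k * h k + (of_nat (Suc n) - of_nat k) * h (Suc k) else 0))"
    by (intro ext)
  then show ?thesis
    by (simp only: derangement_sum_eq_perm_sum perm_sum_Suc[of "Suc n"] perm_sum_add
      perm_sum_marked_fixed_point[where G = "\<lambda>f k. if f = 0 then h (Suc k) else 0"])
qed

lemma derangement_sum_0: "derangement_sum 0 h = h 0"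
proof -
  have "derangements 0 = {id}" by (auto simp: derangements_def)
  then show ?thesis by (simp add: derangement_sum_def excedances_def)
qed

lemma derangement_sum_1: "derangement_sum (Suc 0) h = 0"
  by (simp add: derangement_sum_eq_perm_sum perm_sum_Suc)
     (simp add: perm_sum_def insertion_step_def fixed_points_def excedances_def)

section \<open>Moments of the excedance number\<close>

lemma derangement_sum_cong:
  assumes "\<And>k. f k = g k"
  shows "derangement_sum n f = derangement_sum n g"
  using assms by (simp add: derangement_sum_def)

lemma derangement_sum_add: "derangement_sum n (\<lambda>k. f k + g k) = derangement_sum n f + derangement_sum n g"
  by (simp add: derangement_sum_def sum.distrib)

lemma derangement_sum_cmult: "derangement_sum n (\<lambda>k. c * f k) = c * derangement_sum n f"
  by (simp add: derangement_sum_def sum_distrib_left)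

lemma derangement_sum_const: "derangement_sum n (\<lambda>_. c) = of_nat (derangement_number n) * c"
  by (simp add: derangement_sum_def derangement_number_def)

lemma derangement_number_Suc_Suc:
  "derangement_number (Suc (Suc n)) = Suc n * (derangement_number n + derangement_number (Suc n))"
proof -
  have "int (derangement_number (Suc (Suc n))) = int (Suc n * (derangement_number n + derangement_number (Suc n)))"
    using derangement_sum_Suc_Suc[of n "\<lambda>_. 1::int"] by (simp add: derangement_sum_const algebra_simps)
  then show ?thesis by (simp only: of_nat_eq_iff)
qed

lemma derangement_number_0: "derangement_number 0 = 1"
  and derangement_number_1: "derangement_number (Suc 0) = 0"
proof -
  have "int (derangement_number 0) = 1" "int (derangement_number (Suc 0)) = 0"
    using derangement_sum_const[of _ "1::int"] by (metis derangement_sum_0 mult.right_neutral of_nat_id of_nat_eq_id)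
      (metis derangement_sum_1 derangement_sum_const mult.right_neutral)
  then show "derangement_number 0 = 1" "derangement_number (Suc 0) = 0" by simp_all
qed

lemma derangement_number_Suc:
  "real (derangement_number (Suc n)) = real (Suc n) * real (derangement_number n) + (-1) ^ Suc n"
  by (induction n) (simp_all add: derangement_number_0 derangement_number_1 derangement_number_Suc_Suc algebra_simps)

text \<open>Crude growth, sufficient for \<open>(-1) ^ n / derangement_number n\<close> to vanish in
  the variance formula.\<close>

lemma derangement_number_ge: "n \<ge> 1 \<Longrightarrow> derangement_number n \<ge> n - 1"
proof (induction n rule: induct_nat_012)
  case (ge2 n)
  have "derangement_number n + derangement_number (Suc n) \<ge> 1"
    using ge2(2) derangement_number_0 by (cases n) auto
  then have "Suc n * 1 \<le> Suc n * (derangement_number n + derangement_number (Suc n))"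
    by (rule mult_le_mono2)
  then show ?case
    by (simp add: derangement_number_Suc_Suc)
qed simp_all

text \<open>The recurrence maps the centred weight at size \<open>n + 2\<close> to multiples of the
  centred weights at sizes \<open>n\<close> and \<open>n + 1\<close>, so mean \<open>n / 2\<close>
  propagates.\<close>

lemma derangement_sum_centred: "derangement_sum n (\<lambda>k. real k - real n / 2) = 0"
proof (induction n rule: induct_nat_012)
  case (ge2 n)
  have "derangement_sum (Suc (Suc n)) (\<lambda>k. real k - real (Suc (Suc n)) / 2)
      = real (Suc n) * derangement_sum n (\<lambda>k. real k - real n / 2)
        + derangement_sum (Suc n) (\<lambda>k. real n * (real k - real (Suc n) / 2))"
    by (subst derangement_sum_Suc_Suc)
      (auto intro!: arg_cong2[where f = "(+)"] arg_cong2[where f = "(*)"] derangement_sum_cong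
        simp: field_simps)
  then show ?case
    by (simp only: ge2 derangement_sum_cmult)
qed (simp_all add: derangement_sum_0 derangement_sum_1)

text \<open>The closed form was found by solving the second-moment recurrence with the ansatz
  \<open>(a n + b) D\<^sub>n + (c n + e) (-1)\<^sup>n\<close>.\<close>

lemma derangement_sum_centred_square:
  "derangement_sum n (\<lambda>k. (real k - real n / 2)\<^sup>2)
     = (real n - 1) / 12 * (real (derangement_number n) - (-1) ^ n)"
proof (induction n rule: induct_nat_012)
  case (ge2 n)
  have "derangement_sum (Suc (Suc n)) (\<lambda>k. (real k - real (Suc (Suc n)) / 2)\<^sup>2)
      = real (Suc n) * derangement_sum n (\<lambda>k. (real k - real n / 2)\<^sup>2)
        + derangement_sum (Suc n) (\<lambda>k. (real n - 1) * (real k - real (Suc n) / 2)\<^sup>2 + real (Suc n) / 4)"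
    by (subst derangement_sum_Suc_Suc)
      (auto intro!: arg_cong2[where f = "(+)"] arg_cong2[where f = "(*)"] derangement_sum_cong
        simp: field_simps power2_eq_square)
  also have "\<dots> = real (Suc n) * ((real n - 1) / 12 * (real (derangement_number n) - (-1) ^ n))
      + (real n - 1) * ((real (Suc n) - 1) / 12 * (real (derangement_number (Suc n)) - (-1) ^ Suc n))
      + real (derangement_number (Suc n)) * (real (Suc n) / 4)"
    by (simp only: ge2 derangement_sum_add derangement_sum_cmult derangement_sum_const)
  \<comment> \<open>Both later derangement numbers are expressed through the one at
    \<open>n\<close>, leaving an identity in \<open>n\<close>, that number and the sign.\<close>
  also have "\<dots> = (real (Suc (Suc n)) - 1) / 12 * (real (derangement_number (Suc (Suc n))) - (-1) ^ Suc (Suc n))"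
    by (simp add: derangement_number_Suc[of n] derangement_number_Suc[of "Suc n"] field_simps)
  finally show ?case .
qed (simp_all add: derangement_sum_0 derangement_sum_1 derangement_number_0 derangement_number_1)

section \<open>Real-rootedness of the derangement polynomials\<close>

definition derangement_poly :: "nat \<Rightarrow> complex poly" where
  "derangement_poly n = derangement_sum n (monom 1)"

lemma poly_derangement_poly: "poly (derangement_poly n) z = derangement_sum n (\<lambda>k. z ^ k)"
  by (simp add: derangement_poly_def derangement_sum_def poly_sum poly_monom)

lemma pderiv_sum: "pderiv (\<Sum>i\<in>A. f i) = (\<Sum>i\<in>A. pderiv (f i))"
  by (induction A rule: infinite_finite_induct) (simp_all add: pderiv_add)

lemma poly_pderiv_derangement_poly:
  "poly (pderiv (derangement_poly n)) z = derangement_sum n (\<lambda>k. of_nat k * z ^ (k - 1))"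
  by (simp add: derangement_poly_def derangement_sum_def pderiv_sum poly_sum poly_monom pderiv_monom)

lemma poly_derangement_poly_Suc_Suc:
  "poly (derangement_poly (Suc (Suc n))) z = z * (of_nat (Suc n) * poly (derangement_poly n) z
     + of_nat (Suc n) * poly (derangement_poly (Suc n)) z
     + (1 - z) * poly (pderiv (derangement_poly (Suc n))) z)"
proof -
  have *: "of_nat k * z ^ k + (of_nat (Suc n) - of_nat k) * z ^ Suc k
      = z * (of_nat (Suc n) * z ^ k + (1 - z) * (of_nat k * z ^ (k - 1)))" for k
    by (cases k) (simp_all add: algebra_simps)
  show ?thesis
    unfolding poly_derangement_poly poly_pderiv_derangement_poly derangement_sum_Suc_Suc *
      derangement_sum_cmult derangement_sum_add
    unfolding power_Suc derangement_sum_cmult by (simp only: algebra_simps)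
qed

text \<open>The largest point is never an excedance. The degree saved here provides the strict
  positivity in the half-plane induction.\<close>

lemma degree_derangement_poly: "degree (derangement_poly (Suc n)) \<le> n"
proof -
  have "excedances (Suc n) p \<subseteq> {1..n}" if "p \<in> derangements (Suc n)" for p
  proof
    fix i assume i: "i \<in> excedances (Suc n) p"
    have "p i \<le> Suc n"
      using permutes_in_image[of p "{1..Suc n}" i] that i by (auto simp: derangements_def excedances_def)
    then show "i \<in> {1..n}"
      using i by (auto simp: excedances_def)
  qed
  then have "card (excedances (Suc n) p) \<le> n" if "p \<in> derangements (Suc n)" for p
    using card_mono[of "{1..n}"] that by fastforce
  then show ?thesis
    unfolding derangement_poly_def derangement_sum_def
    by (intro degree_sum_le finite_derangements) (auto intro: order_trans[OF degree_monom_le])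
qed

lemma cnj_poly_derangement_poly: "cnj (poly (derangement_poly n) z) = poly (derangement_poly n) (cnj z)"
  by (simp add: poly_derangement_poly derangement_sum_def)

lemma poly_derangement_poly_pos:
  assumes "n \<ge> 2" and "x > 0"
  shows "poly (derangement_poly n) (complex_of_real x) \<noteq> 0"
proof -
  have "derangement_sum n (\<lambda>k. x ^ k) > 0"
    unfolding derangement_sum_def using assms derangement_number_pos[of n]
    by (intro sum_pos) (auto simp: finite_derangements derangement_number_def)
  moreover have "poly (derangement_poly n) (complex_of_real x) = of_real (derangement_sum n (\<lambda>k. x ^ k))"
    by (simp add: poly_derangement_poly derangement_sum_def)
  ultimately show ?thesis by simp
qed

section \<open>Roots and partial fractions in the upper half plane\<close>

lemma poly_pderiv_prod_linear:
  fixes r :: "nat \<Rightarrow> 'a::field"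
  assumes "\<And>i. i < m \<Longrightarrow> z \<noteq> r i"
  shows "poly (pderiv (\<Prod>i<m. [:- r i, 1:])) z
    = poly (\<Prod>i<m. [:- r i, 1:]) z * (\<Sum>i<m. 1 / (z - r i))"
  using assms
proof (induction m)
  case (Suc m)
  then have "z - r m \<noteq> 0" by auto
  moreover have "poly [:- r m, 1:] z = z - r m" "pderiv [:- r m, 1:] = 1"
    by (simp_all add: pderiv_pCons)
  ultimately show ?case
    using Suc by (simp only: prod.lessThan_Suc sum.lessThan_Suc pderiv_mult poly_add poly_mult
      less_Suc_eq simp_thms) (simp add: field_simps)
qed (simp add: pderiv_1)

text \<open>Real coefficients carry nonvanishing over to the lower half plane by conjugation;
  nonnegative coefficients, not all zero, exclude the positive axis.\<close>

lemma derangement_poly_root_nonpos: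
  assumes "n \<ge> 2" and upper: "\<And>z. Im z > 0 \<Longrightarrow> poly (derangement_poly n) z \<noteq> 0"
    and root: "poly (derangement_poly n) z = 0"
  shows "Im z = 0" and "Re z \<le> 0"
proof -
  have "\<not> Im z < 0"
    using upper[of "cnj z"] root cnj_poly_derangement_poly[of n z] by auto
  with upper[of z] root show *: "Im z = 0" by (meson linorder_less_linear)
  show "Re z \<le> 0"
  proof (rule ccontr)
    assume "\<not> Re z \<le> 0"
    then show False
      using poly_derangement_poly_pos[of n "Re z"] * assms(1) root by (simp add: complex_is_Real_iff of_real_Re)
  qed
qed

lemma Im_inverse_nonneg_iff: "Im (inverse z) \<ge> 0 \<longleftrightarrow> Im z \<le> 0"
  and Im_inverse_nonpos_iff: "Im (inverse z) \<le> 0 \<longleftrightarrow> Im z \<ge> 0"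
proof -
  have "(Re z)\<^sup>2 + (Im z)\<^sup>2 > 0 \<or> z = 0"
    by (simp add: complex_eq_iff sum_power2_gt_zero_iff)
  then show "Im (inverse z) \<ge> 0 \<longleftrightarrow> Im z \<le> 0" "Im (inverse z) \<le> 0 \<longleftrightarrow> Im z \<ge> 0"
    by (auto simp: zero_le_divide_iff divide_le_0_iff)
qed

text \<open>Contribution of a single root \<open>r\<close> to the two quotients below. Division with
  remainder isolates \<open>inverse (z - r)\<close>, whose imaginary part is nonpositive; the signs
  of its coefficients \<open>r * (1 - r)\<close> and \<open>1 - r\<close> follow from
  \<open>r \<le> 0\<close>.\<close>

lemma Im_partial_fractions:
  fixes z :: complex and r :: real
  assumes "Im z > 0" and "r \<le> 0"
  shows "Im (z * (1 - z) * (1 / (z - of_real r))) \<ge> - Im z"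
    and "Im ((1 - z) * (1 / (z - of_real r))) \<le> 0"
proof -
  have nz: "z - of_real r \<noteq> 0"
    using assms(1) by (auto simp: complex_eq_iff)
  have neg: "Im (inverse (z - of_real r)) \<le> 0"
    using assms(1) by (simp only: Im_inverse_nonpos_iff) simp
  have "z * (1 - z) * (1 / (z - of_real r))
      = of_real (1 - r) - z + of_real (r * (1 - r)) * inverse (z - of_real r)"
    using nz by (simp add: field_simps)
  moreover have "r * (1 - r) * Im (inverse (z - of_real r)) \<ge> 0"
    using neg assms(2) by (intro mult_nonpos_nonpos) (auto simp: mult_nonpos_nonneg)
  ultimately show "Im (z * (1 - z) * (1 / (z - of_real r))) \<ge> - Im z"
    by simp
  have "(1 - z) * (1 / (z - of_real r)) = of_real (1 - r) * inverse (z - of_real r) - 1"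
    using nz by (simp add: field_simps)
  moreover have "(1 - r) * Im (inverse (z - of_real r)) \<le> 0"
    using neg assms(2) by (intro mult_nonneg_nonpos) auto
  ultimately show "Im ((1 - z) * (1 / (z - of_real r))) \<le> 0"
    by simp
qed

text \<open>Each sign condition controls one way of dividing the recurrence: by the current
  polynomial, or by \<open>z\<close> times it. Together they reproduce themselves. The index starts
  at 2 because the polynomial at 1 is zero.\<close>

lemma derangement_poly_upper_half_plane:
  fixes z :: complex
  assumes "Im z > 0"
  shows "poly (derangement_poly (Suc (Suc n))) z \<noteq> 0
    \<and> Im (poly (derangement_poly (Suc n)) z / poly (derangement_poly (Suc (Suc n))) z) \<le> 0
    \<and> Im (z * (poly (derangement_poly (Suc n)) z / poly (derangement_poly (Suc (Suc n))) z)) \<ge> 0"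
  using assms
proof (induction n arbitrary: z)
  case 0
  have "poly (derangement_poly (Suc (Suc 0))) z = z"
    unfolding poly_derangement_poly derangement_sum_Suc_Suc by (simp add: derangement_sum_0 derangement_sum_1)
  moreover have "poly (derangement_poly (Suc 0)) z = 0"
    unfolding poly_derangement_poly by (simp add: derangement_sum_1)
  ultimately show ?case
    using 0 by auto
next
  case (Suc n)
  let ?d = "\<lambda>k. poly (derangement_poly k) z"
  let ?m = "degree (derangement_poly (Suc (Suc n)))" and ?N = "Suc (Suc n)"
  obtain r where r: "smult (lead_coeff (derangement_poly ?N)) (\<Prod>i<?m. [:- r i, 1:]) = derangement_poly ?N"
    by (rule complex_poly_decompose')
  have upper: "\<And>z. Im z > 0 \<Longrightarrow> poly (derangement_poly ?N) z \<noteq> 0"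
    using Suc.IH by blast
  have root: "poly (derangement_poly ?N) (r i) = 0" if "i < ?m" for i
    by (subst r[symmetric]) (use that in \<open>auto simp: poly_prod\<close>)
  have r_real: "r i = of_real (Re (r i))" and r_nonpos: "Re (r i) \<le> 0" if "i < ?m" for i
    using derangement_poly_root_nonpos[OF _ upper root[OF that]] by (auto simp: complex_eq_iff)
  define S where "S = (\<Sum>i<?m. 1 / (z - r i))"
  have z0: "z \<noteq> 0" and dN: "?d ?N \<noteq> 0"
    using Suc.prems upper by auto
  have "poly (pderiv (derangement_poly ?N)) z = ?d ?N * S"
  proof -
    have "z \<noteq> r i" if "i < ?m" for i
      using dN root[OF that] by auto
    then show ?thesis
      unfolding S_def by (subst (1 2) r[symmetric]) (simp add: pderiv_smult poly_pderiv_prod_linear)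
  qed
  then have rec: "?d (Suc ?N) = z * (of_nat ?N * ?d (Suc n) + of_nat ?N * ?d ?N + (1 - z) * (?d ?N * S))"
    using poly_derangement_poly_Suc_Suc[of "Suc n" z] by simp
  define w where "w = ?d (Suc n) / ?d ?N"
  have w: "Im w \<le> 0" "Im (z * w) \<ge> 0"
    using Suc.IH[OF Suc.prems] by (simp_all add: w_def)
  have quot: "?d (Suc ?N) / ?d ?N = of_nat ?N * (z * w) + of_nat ?N * z + z * (1 - z) * S"
    unfolding rec w_def using dN by (simp add: field_simps)
  \<comment> \<open>Each root costs at most \<open>Im z\<close>, and there are at most
    \<open>n + 1\<close> of them, while \<open>of_nat ?N * z\<close> contributes
    \<open>n + 2\<close> copies: one \<open>Im z\<close> is left over.\<close>
  have "Im (z * (1 - z) * S) \<ge> (\<Sum>i<?m. - Im z)"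
    unfolding S_def sum_distrib_left Im_sum
    using Im_partial_fractions(1)[OF Suc.prems r_nonpos] r_real by (intro sum_mono) (metis lessThan_iff)
  moreover have "real ?m \<le> real (Suc n)"
    using degree_derangement_poly[of "Suc n"] by (simp only: of_nat_le_iff)
  then have "real ?m * Im z \<le> real (Suc n) * Im z"
    using Suc.prems by (intro mult_right_mono) auto
  ultimately have "Im (z * (1 - z) * S) \<ge> - (real (Suc n) * Im z)"
    by (simp only: sum_constant card_lessThan)
  moreover have "Im (of_nat ?N * (z * w)) \<ge> 0"
    using w(2) by (simp del: of_nat_Suc add: complex_eq_iff)
  ultimately have "Im (?d (Suc ?N) / ?d ?N) \<ge> Im z"
    unfolding quot by (simp add: algebra_simps)
  then have pos: "Im (?d (Suc ?N) / ?d ?N) > 0"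
    using Suc.prems by simp
  then have nz: "?d (Suc ?N) \<noteq> 0" by auto
  have 1: "Im (?d ?N / ?d (Suc ?N)) \<le> 0"
    using Im_inverse_nonpos_iff[of "?d (Suc ?N) / ?d ?N"] pos by simp
  \<comment> \<open>Dividing by \<open>z\<close> as well removes the outer factor; now every
    nonconstant term has nonpositive imaginary part, and inversion yields the second
    condition.\<close>
  have "?d (Suc ?N) / (z * ?d ?N) = of_nat ?N * w + of_nat ?N + (1 - z) * S"
    unfolding rec w_def using dN z0 by (simp add: field_simps)
  moreover have "Im ((1 - z) * S) \<le> 0"
    unfolding S_def sum_distrib_left Im_sum
    using Im_partial_fractions(2)[OF Suc.prems r_nonpos] r_real by (intro sum_nonpos) (metis lessThan_iff)
  moreover have "Im (of_nat ?N * w) \<le> 0"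
    using w(1) by (simp del: of_nat_Suc add: mult_nonneg_nonpos)
  ultimately have "Im (?d (Suc ?N) / (z * ?d ?N)) \<le> 0"
    by simp
  then have "Im (z * (?d ?N / ?d (Suc ?N))) \<ge> 0"
    using Im_inverse_nonneg_iff[of "?d (Suc ?N) / (z * ?d ?N)"] by (simp add: mult.commute)
  with 1 nz show ?case by blast
qed

section \<open>The derangement distribution\<close>

lemma derangement_expectation:
  assumes "n \<ge> 2"
  shows "measure_pmf.expectation (derangement_pmf n) g
    = derangement_sum n (\<lambda>k. g (int k)) / real (derangement_number n)"
proof -
  let ?D = "real (derangement_number n)"
  have "measure_pmf.expectation (derangement_pmf n) g = (\<Sum>k\<in>{0..int n}. pmf (derangement_pmf n) k *\<^sub>R g k)"
    by (intro integral_measure_pmf)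
      (use derangement_eulerian_eq_0[of _ n] in \<open>fastforce simp: set_pmf_iff pmf_derangement_pmf[OF assms]\<close>)+
  also have "\<dots> = (\<Sum>k\<in>{0..int n}. real (derangement_eulerian n k) * g k) / ?D"
    by (simp add: pmf_derangement_pmf[OF assms] sum_divide_distrib)
  also have "(\<Sum>k\<in>{0..int n}. real (derangement_eulerian n k) * g k)
      = (\<Sum>k\<in>{0..int n}. \<Sum>p | p \<in> derangements n \<and> int (card (excedances n p)) = k.
          g (int (card (excedances n p))))"
    by (intro sum.cong refl) (simp add: derangement_eulerian_def)
  also have "\<dots> = derangement_sum n (\<lambda>k. g (int k))"
    unfolding derangement_sum_def
    by (rule sum.group) (use card_excedances_le in \<open>auto simp: finite_derangements\<close>)
  finally show ?thesis .
qed

lemma derangement_sum_id: "derangement_sum n real = real (derangement_number n) * (real n / 2)"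
  using derangement_sum_add[of n "\<lambda>k. real k - real n / 2" "\<lambda>_. real n / 2"]
  by (simp add: derangement_sum_centred derangement_sum_const)

lemma derangement_sd_nonneg [simp]: "derangement_sd n \<ge> 0"
  by (simp add: derangement_sd_def)

lemma derangement_mean_eq: "n \<ge> 2 \<Longrightarrow> derangement_mean n = real n / 2"
  using derangement_number_pos[of n]
  by (simp add: derangement_mean_def derangement_expectation derangement_sum_id)

lemma derangement_variance:
  assumes "n \<ge> 2"
  shows "(derangement_sd n)\<^sup>2 = derangement_sum n (\<lambda>k. (real k - real n / 2)\<^sup>2) / real (derangement_number n)"
proof -
  have "measure_pmf.variance (derangement_pmf n) real_of_int
      = derangement_sum n (\<lambda>k. (real k - real n / 2)\<^sup>2) / real (derangement_number n)"
    using derangement_mean_eq[OF assms] unfolding derangement_mean_def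
    by (simp only: derangement_expectation[OF assms] of_int_of_nat_eq)
  moreover have "\<dots> \<ge> 0"
    by (auto simp: derangement_sum_def intro!: sum_nonneg divide_nonneg_nonneg)
  ultimately show ?thesis by (simp add: derangement_sd_def)
qed

section \<open>Asymptotics of the variance\<close>

lemma derangement_variance_eq:
  assumes "n \<ge> 2"
  shows "(derangement_sd n)\<^sup>2 = (real n - 1) / 12 * (1 - (-1) ^ n / real (derangement_number n))"
  using derangement_number_pos[OF assms]
  unfolding derangement_variance[OF assms] derangement_sum_centred_square by (simp add: field_simps)

lemma derangement_variance_asymp: "(\<lambda>n. (derangement_sd n)\<^sup>2) \<sim>[at_top] (\<lambda>n. real n / 12)"
proof (rule asymp_equivI')
  have "(\<lambda>n. (-1) ^ n / real (derangement_number n)) \<longlonglongrightarrow> 0"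
  proof (rule Lim_null_comparison)
    show "\<forall>\<^sub>F n in sequentially. norm ((-1) ^ n / real (derangement_number n)) \<le> 1 / (real n - 1)"
      using eventually_ge_at_top[of 2]
    proof eventually_elim
      case (elim n)
      then have "real (derangement_number n) \<ge> real n - 1"
        using derangement_number_ge[of n] by linarith
      then show ?case
        using elim by (simp add: power_abs norm_divide divide_simps)
    qed
    show "(\<lambda>n. 1 / (real n - 1)) \<longlonglongrightarrow> 0" by real_asymp
  qed
  moreover have "(\<lambda>n. (real n - 1) / real n) \<longlonglongrightarrow> 1" by real_asymp
  ultimately have "(\<lambda>n. (real n - 1) / real n * (1 - (-1) ^ n / real (derangement_number n))) \<longlonglongrightarrow> 1 * (1 - 0)"
    by (intro tendsto_intros)
  moreover have "\<forall>\<^sub>F n in sequentially. (real n - 1) / real n * (1 - (-1) ^ n / real (derangement_number n))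
      = (derangement_sd n)\<^sup>2 / (real n / 12)"
    using eventually_ge_at_top[of 2] by eventually_elim (simp add: derangement_variance_eq)
  ultimately have "(\<lambda>n. (derangement_sd n)\<^sup>2 / (real n / 12)) \<longlonglongrightarrow> 1 * (1 - 0)"
    by (rule Lim_transform_eventually)
  then show "(\<lambda>n. (derangement_sd n)\<^sup>2 / (real n / 12)) \<longlonglongrightarrow> 1"
    by simp
qed

lemma derangement_sd_at_top: "filterlim derangement_sd at_top sequentially"
proof -
  have "filterlim (\<lambda>n. real n / 12) at_top sequentially" by real_asymp
  then have "filterlim (\<lambda>n. (derangement_sd n)\<^sup>2) at_top sequentially"
    using asymp_equiv_at_top_transfer[OF asymp_equiv_symI[OF derangement_variance_asymp]] by blast
  then have "filterlim (\<lambda>n. sqrt ((derangement_sd n)\<^sup>2)) at_top sequentially"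
    by (rule filterlim_compose[OF sqrt_at_top])
  then show ?thesis by simp
qed

section \<open>Factorization into Bernoulli generating functions\<close>

lemma bernoulli_product_moments:
  fixes p :: "nat \<Rightarrow> 'a::field"
  defines "P \<equiv> \<lambda>m. \<Prod>i<m. [:1 - p i, p i:]"
  shows "poly (P m) 1 = 1"
    and "poly (pderiv (P m)) 1 = (\<Sum>i<m. p i)"
    and "poly (pderiv (pderiv (P m))) 1 = (\<Sum>i<m. p i)\<^sup>2 - (\<Sum>i<m. (p i)\<^sup>2)"
proof -
  have P: "P (Suc m) = P m * [:1 - p m, p m:]" "P 0 = 1" for m
    by (simp_all add: P_def del: mult_pCons_right)
  have lin: "pderiv [:1 - p m, p m:] = [:p m:]" "pderiv [:p m:] = 0" "poly [:1 - p m, p m:] 1 = 1"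
    "poly [:p m:] 1 = p m" for m
    by (simp_all add: pderiv_pCons)
  show 0: "poly (P m) 1 = 1" for m
    by (induction m) (simp_all only: P lin poly_mult poly_1 mult_1)
  show 1: "poly (pderiv (P m)) 1 = (\<Sum>i<m. p i)" for m
    by (induction m) (simp_all add: P lin pderiv_mult 0 pderiv_1 del: mult_pCons_right mult_pCons_left)
  \<comment> \<open>Linear factors have zero second derivative, so a new factor adds only twice its
    parameter times the sum of the earlier ones.\<close>
  show "poly (pderiv (pderiv (P m))) 1 = (\<Sum>i<m. p i)\<^sup>2 - (\<Sum>i<m. (p i)\<^sup>2)"
    by (induction m) (simp_all add: P lin pderiv_mult pderiv_add 0 1 pderiv_1 power2_eq_square algebra_simps
      del: mult_pCons_right mult_pCons_left)
qed

text \<open>A real-rooted polynomial with nonpositive roots \<open>r\<^sub>i\<close> is, after normalization, the generating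
  function of a sum of independent Bernoulli variables with parameters \<open>1 / (1 - r\<^sub>i)\<close>.\<close>

lemma derangement_bernoulli_factorization:
  assumes "n \<ge> 2"
  obtains m and p :: "nat \<Rightarrow> real" where
    "\<forall>i<m. 0 \<le> p i \<and> p i \<le> 1"
    "\<forall>z. derangement_sum n (\<lambda>k. z ^ k)
      = of_nat (derangement_number n) * (\<Prod>i<m. 1 - of_real (p i) + of_real (p i) * (z::complex))"
    "(\<Sum>i<m. p i) = real n / 2"
    "(\<Sum>i<m. p i * (1 - p i)) = (derangement_sd n)\<^sup>2"
proof -
  let ?d = "derangement_poly n" and ?D = "derangement_number n"
  let ?c = "lead_coeff ?d"
  have D: "?D > 0" using derangement_number_pos[OF assms] .
  define m where "m = degree ?d"
  obtain r where r: "smult ?c (\<Prod>i<m. [:- r i, 1:]) = ?d"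
    unfolding m_def by (rule complex_poly_decompose')
  obtain k where k: "n = Suc (Suc k)"
    using assms by (metis One_nat_def Suc_le_D numeral_2_eq_2 Suc_le_mono)
  have upper: "Im z > 0 \<Longrightarrow> poly ?d z \<noteq> 0" for z
    using derangement_poly_upper_half_plane[of z k] k by blast
  have root: "poly ?d (r i) = 0" if "i < m" for i
    by (subst r[symmetric]) (use that in \<open>auto simp: poly_prod\<close>)
  have r_real: "r i = of_real (Re (r i))" and r_nonpos: "Re (r i) \<le> 0" if "i < m" for i
    using derangement_poly_root_nonpos[OF assms upper root[OF that]] by (auto simp: complex_eq_iff)
  define p where "p i = 1 / (1 - Re (r i))" for i
  have p: "0 \<le> p i \<and> p i \<le> 1" if "i < m" for i
    using r_nonpos[OF that] by (simp add: p_def)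
  have lin: "z - r i = (1 - r i) * (1 - of_real (p i) + of_real (p i) * z)" if "i < m" for i z
  proof -
    have "1 - complex_of_real (Re (r i)) \<noteq> 0"
      using r_nonpos[OF that] by (auto simp: complex_eq_iff)
    then have "(1 - r i) * of_real (p i) = 1"
      unfolding p_def by (subst r_real[OF that]) simp
    moreover have "(1 - r i) * (1 - of_real (p i) + of_real (p i) * z)
        = (1 - r i) - (1 - r i) * of_real (p i) + (1 - r i) * of_real (p i) * z"
      by (simp only: distrib_left right_diff_distrib mult.assoc mult_1_right)
    ultimately show ?thesis
      by simp
  qed
  define C where "C = ?c * (\<Prod>i<m. 1 - r i)"
  have poly_C: "poly ?d z = C * (\<Prod>i<m. 1 - of_real (p i) + of_real (p i) * z)" for z
  proof -
    have "poly ?d z = ?c * (\<Prod>i<m. z - r i)"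
      by (subst r[symmetric]) (simp add: poly_prod)
    also have "(\<Prod>i<m. z - r i) = (\<Prod>i<m. (1 - r i) * (1 - of_real (p i) + of_real (p i) * z))"
      by (intro prod.cong refl lin) simp
    finally show ?thesis
      by (simp only: prod.distrib C_def mult.assoc)
  qed
  \<comment> \<open>Every Bernoulli factor equals 1 at 1, so this evaluation identifies the
    normalizing constant \<open>C\<close>.\<close>
  have "poly ?d 1 = of_nat ?D"
    by (simp add: poly_derangement_poly derangement_sum_const)
  then have "C = of_nat ?D"
    unfolding poly_C by simp
  note poly_d = poly_C[unfolded this]
  define P where "P = (\<Prod>i<m. [:1 - of_real (p i), of_real (p i):] :: complex poly)"
  have "poly ?d = poly (smult (of_nat ?D) P)"
    by (simp add: fun_eq_iff poly_d P_def poly_prod mult.commute)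
  then have d: "?d = smult (of_nat ?D) P"
    by (simp only: poly_eq_poly_eq_iff)
  \<comment> \<open>Derivatives at 1 are factorial moments: the first fixes the sum of the
    parameters, the second the sum of their squares.\<close>
  have "of_real (derangement_sum n real) = poly (pderiv ?d) 1"
    by (simp add: poly_pderiv_derangement_poly) (simp add: derangement_sum_def)
  also have "\<dots> = of_real (real ?D * (\<Sum>i<m. p i))"
    unfolding d by (simp add: pderiv_smult P_def bernoulli_product_moments)
  finally have mean: "(\<Sum>i<m. p i) = real n / 2"
    using D by (simp only: of_real_eq_iff derangement_sum_id) simp
  have "of_real (derangement_sum n (\<lambda>k. real k * (real k - 1))) = poly (pderiv (pderiv ?d)) 1"
  proof -
    have *: "of_nat (k - Suc 0) * of_nat k = complex_of_nat k * (of_nat k - 1)" for k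
      by (cases k) auto
    show ?thesis
      by (simp add: derangement_poly_def derangement_sum_def pderiv_sum pderiv_monom poly_sum poly_monom *)
  qed
  also have "\<dots> = of_real (real ?D * ((\<Sum>i<m. p i)\<^sup>2 - (\<Sum>i<m. (p i)\<^sup>2)))"
    unfolding d by (simp add: pderiv_smult P_def bernoulli_product_moments)
  finally have second: "derangement_sum n (\<lambda>k. real k * (real k - 1))
      = real ?D * ((\<Sum>i<m. p i)\<^sup>2 - (\<Sum>i<m. (p i)\<^sup>2))"
    unfolding of_real_eq_iff .
  have "derangement_sum n (\<lambda>k. (real k - real n / 2)\<^sup>2)
      = derangement_sum n (\<lambda>k. real k * (real k - 1) + ((1 - real n) * real k + (real n / 2)\<^sup>2))"
    by (rule derangement_sum_cong) (simp add: power2_eq_square field_simps)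
  also have "\<dots> = real ?D * (real n / 2 - (\<Sum>i<m. (p i)\<^sup>2))"
    by (simp only: derangement_sum_add derangement_sum_cmult derangement_sum_const second[unfolded mean] derangement_sum_id)
      (simp add: power2_eq_square field_simps)
  finally have "(derangement_sd n)\<^sup>2 = (\<Sum>i<m. p i) - (\<Sum>i<m. (p i)\<^sup>2)"
    using D by (simp add: derangement_variance[OF assms] mean)
  also have "\<dots> = (\<Sum>i<m. p i * (1 - p i))"
    by (simp add: right_diff_distrib sum_subtractf power2_eq_square)
  finally have "(\<Sum>i<m. p i * (1 - p i)) = (derangement_sd n)\<^sup>2" by simp
  with p poly_d mean show ?thesis
    by (intro that[of m p]) (auto simp: poly_derangement_poly)
qed

section \<open>Characteristic functions\<close>

text \<open>With \<open>y = \<bar>x\<bar> / 2 \<le> 2\<close>, the bound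
  \<open>sin y \<ge> y - y ^ 3 / 6 \<ge> y / 3\<close> enters
  \<open>1 - cos x = 2 * (sin y)\<^sup>2\<close>, which gives the constant 18.\<close>

lemma one_minus_cos_ge:
  assumes "\<bar>x\<bar> \<le> pi"
  shows "1 - cos x \<ge> x\<^sup>2 / 18"
proof -
  let ?y = "\<bar>x\<bar> / 2"
  have y: "0 \<le> ?y" "?y \<le> 2" using assms pi_less_4 by auto
  have "\<bar>sin ?y - ?y\<bar> \<le> ?y ^ 3 / 6"
    using Maclaurin_sin_bound[of ?y 3] by (simp add: numeral_3_eq_3 sin_coeff_def fact_numeral)
  moreover have "?y ^ 3 \<le> ?y * 4"
    using mult_left_mono[OF power_mono[OF y(2,1), of 2] y(1)] by (simp add: power3_eq_cube power2_eq_square)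
  ultimately have "sin ?y \<ge> ?y / 3" by linarith
  then have "(sin ?y)\<^sup>2 \<ge> (?y / 3)\<^sup>2"
    using y(1) by (intro power_mono) auto
  moreover have "cos x = 1 - 2 * (sin ?y)\<^sup>2"
    using cos_double_sin[of ?y] by (simp add: cos_abs_real)
  ultimately show ?thesis by (simp add: power2_eq_square)
qed

section \<open>Centred Bernoulli factors\<close>

definition centred_bernoulli_char :: "real \<Rightarrow> real \<Rightarrow> complex" where
  "centred_bernoulli_char p t = iexp (- (p * t)) * (1 - of_real p + of_real p * iexp t)"

lemma norm_centred_bernoulli_char_power2:
  "(norm (centred_bernoulli_char p t))\<^sup>2 = 1 - 2 * (p * (1 - p)) * (1 - cos t)"
proof -
  have "norm (centred_bernoulli_char p t) = norm (1 - of_real p + of_real p * iexp t)"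
    by (simp add: centred_bernoulli_char_def norm_mult)
  also have "\<dots>\<^sup>2 = (1 - p + p * cos t)\<^sup>2 + (p * sin t)\<^sup>2"
    by (simp add: cmod_power2 Re_exp Im_exp)
  also have "\<dots> = 1 - 2 * (p * (1 - p)) * (1 - cos t)"
    by (simp add: power_mult_distrib sin_squared_eq) (simp add: power2_eq_square algebra_simps)
  finally show ?thesis .
qed

lemma norm_centred_bernoulli_char_le_1:
  assumes "0 \<le> p" "p \<le> 1"
  shows "norm (centred_bernoulli_char p t) \<le> 1"
proof -
  have "(norm (centred_bernoulli_char p t))\<^sup>2 \<le> 1\<^sup>2"
    using assms by (simp add: norm_centred_bernoulli_char_power2)
  then show ?thesis by (rule power2_le_imp_le) simp
qed

text \<open>Apply \<open>1 - x \<le> exp (- x)\<close> to the squared modulus. The exponent is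
  proportional to the Bernoulli variance, so these bounds multiply into one that involves only the
  total variance.\<close>

lemma norm_centred_bernoulli_char_le:
  assumes "0 \<le> p" "p \<le> 1" "\<bar>t\<bar> \<le> pi"
  shows "norm (centred_bernoulli_char p t) \<le> exp (- (p * (1 - p)) * (t\<^sup>2 / 18))"
proof -
  have "(norm (centred_bernoulli_char p t))\<^sup>2 \<le> 1 - 2 * (p * (1 - p)) * (t\<^sup>2 / 18)"
    using assms mult_left_mono[OF one_minus_cos_ge[OF assms(3)], of "2 * (p * (1 - p))"]
    by (simp add: norm_centred_bernoulli_char_power2)
  also have "\<dots> \<le> exp (- (2 * (p * (1 - p)) * (t\<^sup>2 / 18)))"
    using exp_ge_add_one_self[of "- (2 * (p * (1 - p)) * (t\<^sup>2 / 18))"] by simp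
  also have "\<dots> = (exp (- (p * (1 - p)) * (t\<^sup>2 / 18)))\<^sup>2"
    by (simp add: exp_double[symmetric])
  finally show ?thesis by (rule power2_le_imp_le) simp
qed

lemma iexp_quadratic_approx: "norm (iexp x - (1 + \<i> * x - of_real (x\<^sup>2 / 2))) \<le> \<bar>x\<bar> ^ 3 / 6"
proof -
  have "(\<Sum>k\<le>2. (\<i> * of_real x) ^ k / fact k) = 1 + \<i> * x - of_real (x\<^sup>2 / 2)"
  proof -
    have "{..2} = {0, 1, 2::nat}" by auto
    then show ?thesis by (simp add: power_mult_distrib)
  qed
  then show ?thesis
    using iexp_approx1[of x 2] by (simp add: fact_numeral eval_nat_numeral)
qed

lemma exp_minus_linear_approx:
  fixes a :: real
  assumes "a \<ge> 0"
  shows "\<bar>exp (- a) - (1 - a)\<bar> \<le> a\<^sup>2 / 2"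
proof -
  have "exp (- a) \<ge> 1 - a" using exp_ge_add_one_self[of "- a"] by simp
  moreover have "exp (- a) \<le> 1 - a + a\<^sup>2 / 2"
  proof -
    \<comment> \<open>The second factor is a lower bound for \<open>exp a\<close>, so a product of
      at least 1 bounds \<open>exp (- a)\<close> by the first.\<close>
    have "(1 - a + a\<^sup>2 / 2) * (1 + a + a\<^sup>2 / 2) = 1 + (a\<^sup>2)\<^sup>2 / 4"
      by (simp add: power2_eq_square field_simps)
    then have "1 \<le> (1 - a + a\<^sup>2 / 2) * (1 + a + a\<^sup>2 / 2)"
      by simp
    also have "\<dots> \<le> (1 - a + a\<^sup>2 / 2) * exp a"
    proof (rule mult_left_mono)
      have "1 - a + a\<^sup>2 / 2 = ((1 - a)\<^sup>2 + 1) / 2"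
        by (simp add: power2_eq_square field_simps)
      also have "\<dots> \<ge> 0" by simp
      finally show "0 \<le> 1 - a + a\<^sup>2 / 2" .
    qed (use exp_lower_Taylor_quadratic[OF assms] in simp)
    finally show ?thesis
      by (simp add: exp_minus field_simps)
  qed
  ultimately show ?thesis by (simp add: abs_le_iff)
qed

text \<open>Both sides agree to second order in \<open>t\<close>. The error keeps a factor
  \<open>p * (1 - p)\<close>, so that errors summed over all Bernoulli factors are controlled by the
  variance.\<close>

lemma centred_bernoulli_char_approx:
  assumes "0 \<le> p" "p \<le> 1"
  shows "norm (centred_bernoulli_char p t - of_real (exp (- (p * (1 - p) * t\<^sup>2 / 2))))
    \<le> p * (1 - p) * (\<bar>t\<bar> ^ 3 / 6 + t ^ 4 / 8)"
proof -
  let ?q = "1 - p"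
  let ?R = "\<lambda>x::real. iexp x - (1 + \<i> * x - of_real (x\<^sup>2 / 2))"
  have q: "0 \<le> ?q" "?q \<le> 1" using assms by auto
  have pq: "0 \<le> p * ?q" "p * ?q \<le> 1"
    using assms q by (auto intro: mult_le_one)
  have char: "centred_bernoulli_char p t = of_real ?q * iexp (- (p * t)) + of_real p * iexp (?q * t)"
    by (simp add: centred_bernoulli_char_def algebra_simps exp_add[symmetric])
  have "centred_bernoulli_char p t - of_real (1 - p * ?q * t\<^sup>2 / 2)
      = of_real ?q * ?R (- (p * t)) + of_real p * ?R (?q * t)"
    unfolding char by (simp add: power2_eq_square field_simps)
  also have "norm \<dots> \<le> ?q * (\<bar>- (p * t)\<bar> ^ 3 / 6) + p * (\<bar>?q * t\<bar> ^ 3 / 6)"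
  proof (intro norm_triangle_le add_mono)
    have norm_scale: "norm (of_real a * z) = a * norm z" if "a \<ge> 0" for a and z :: complex
      using that by (simp add: norm_mult)
    show "norm (of_real ?q * ?R (- (p * t))) \<le> ?q * (\<bar>- (p * t)\<bar> ^ 3 / 6)"
      unfolding norm_scale[OF q(1)] by (intro mult_left_mono iexp_quadratic_approx q)
    show "norm (of_real p * ?R (?q * t)) \<le> p * (\<bar>?q * t\<bar> ^ 3 / 6)"
      unfolding norm_scale[OF assms(1)] by (intro mult_left_mono iexp_quadratic_approx assms)
  qed
  \<comment> \<open>This is the third absolute central moment
    \<open>?q * p ^ 3 + p * ?q ^ 3\<close>, factored to expose the variance.\<close>
  also have "\<dots> = p * ?q * (p\<^sup>2 + ?q\<^sup>2) * (\<bar>t\<bar> ^ 3 / 6)"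
    using assms q by (simp add: abs_mult power_mult_distrib) (simp add: eval_nat_numeral field_simps)
  also have "\<dots> \<le> p * ?q * 1 * (\<bar>t\<bar> ^ 3 / 6)"
  proof -
    have "p\<^sup>2 + ?q\<^sup>2 = 1 - 2 * (p * ?q)" by (simp add: power2_eq_square algebra_simps)
    then have "p\<^sup>2 + ?q\<^sup>2 \<le> 1" using pq by simp
    then show ?thesis using pq by (intro mult_right_mono mult_left_mono) auto
  qed
  finally have 1: "norm (centred_bernoulli_char p t - of_real (1 - p * ?q * t\<^sup>2 / 2)) \<le> p * ?q * (\<bar>t\<bar> ^ 3 / 6)"
    by simp
  have "norm (complex_of_real (1 - p * ?q * t\<^sup>2 / 2) - of_real (exp (- (p * ?q * t\<^sup>2 / 2))))
      = \<bar>exp (- (p * ?q * t\<^sup>2 / 2)) - (1 - p * ?q * t\<^sup>2 / 2)\<bar>"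
    unfolding of_real_diff[symmetric] norm_of_real by (rule abs_minus_commute)
  also have "\<dots> \<le> (p * ?q * t\<^sup>2 / 2)\<^sup>2 / 2"
    using pq by (intro exp_minus_linear_approx) auto
  also have "\<dots> = (p * ?q) * (p * ?q) * (t ^ 4 / 8)"
    by (simp add: power2_eq_square eval_nat_numeral)
  also have "\<dots> \<le> (p * ?q) * 1 * (t ^ 4 / 8)"
    using pq by (intro mult_right_mono mult_left_mono) auto
  finally have 2: "norm (complex_of_real (1 - p * ?q * t\<^sup>2 / 2) - of_real (exp (- (p * ?q * t\<^sup>2 / 2))))
      \<le> p * ?q * (t ^ 4 / 8)"
    by simp
  show ?thesis
    using norm_triangle_le[OF add_mono[OF 1 2]] by (simp add: distrib_left)
qed

section \<open>The standardized characteristic function\<close>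

definition derangement_char :: "nat \<Rightarrow> real \<Rightarrow> complex" where
  "derangement_char n s =
     derangement_sum n (\<lambda>k. iexp (s * ((real k - real n / 2) / derangement_sd n))) / of_nat (derangement_number n)"

text \<open>Evaluate the generating function at \<open>iexp t\<close>; since the parameters sum to
  \<open>n / 2\<close>, the centring phase distributes over the factors.\<close>

lemma derangement_char_factorization:
  assumes "n \<ge> 2"
  obtains m and p :: "nat \<Rightarrow> real" where
    "\<forall>i<m. 0 \<le> p i \<and> p i \<le> 1"
    "\<forall>s. derangement_char n s = (\<Prod>i<m. centred_bernoulli_char (p i) (s / derangement_sd n))"
    "(\<Sum>i<m. p i * (1 - p i)) = (derangement_sd n)\<^sup>2"
proof -
  obtain m :: nat and p where p: "\<forall>i<m. 0 \<le> p i \<and> p i \<le> 1"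
    and fact: "\<forall>z. derangement_sum n (\<lambda>k. z ^ k)
      = of_nat (derangement_number n) * (\<Prod>i<m. 1 - of_real (p i) + of_real (p i) * (z::complex))"
    and mean: "(\<Sum>i<m. p i) = real n / 2"
    and var: "(\<Sum>i<m. p i * (1 - p i)) = (derangement_sd n)\<^sup>2"
    by (rule derangement_bernoulli_factorization[OF assms])
  have "\<forall>s. derangement_char n s = (\<Prod>i<m. centred_bernoulli_char (p i) (s / derangement_sd n))"
  proof
    fix s
    define t where "t = s / derangement_sd n"
    have "iexp (s * ((real k - real n / 2) / derangement_sd n)) = iexp (- (\<Sum>i<m. p i) * t) * iexp t ^ k" for k
    proof -
      have "s * ((real k - real n / 2) / derangement_sd n) = real k * t + - (\<Sum>i<m. p i) * t"
        unfolding mean t_def by (simp add: algebra_simps diff_divide_distrib)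
      then show ?thesis
        by (simp only: of_real_add of_real_mult of_real_of_nat_eq distrib_left exp_add exp_of_nat_mult[symmetric] mult_ac)
    qed
    then have "derangement_char n s = iexp (- (\<Sum>i<m. p i) * t) * (\<Prod>i<m. 1 - of_real (p i) + of_real (p i) * iexp t)"
      using derangement_number_pos[OF assms]
      by (simp only: derangement_char_def derangement_sum_cmult spec[OF fact]) simp
    also have "iexp (- (\<Sum>i<m. p i) * t) = (\<Prod>i<m. iexp (- (p i * t)))"
      by (simp add: exp_sum[symmetric] sum_distrib_left sum_distrib_right sum_negf)
    finally show "derangement_char n s = (\<Prod>i<m. centred_bernoulli_char (p i) (s / derangement_sd n))"
      by (simp add: centred_bernoulli_char_def prod.distrib t_def)
  qed
  then show ?thesis
    using p var by (intro that[of m p])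
qed

lemma norm_derangement_char_le:
  assumes "n \<ge> 2" and sd: "derangement_sd n > 0" and s: "\<bar>s\<bar> \<le> pi * derangement_sd n"
  shows "norm (derangement_char n s) \<le> exp (- (s\<^sup>2 / 18))"
proof -
  obtain m :: nat and p where p: "\<forall>i<m. 0 \<le> p i \<and> p i \<le> 1"
    and fact: "\<forall>s. derangement_char n s = (\<Prod>i<m. centred_bernoulli_char (p i) (s / derangement_sd n))"
    and var: "(\<Sum>i<m. p i * (1 - p i)) = (derangement_sd n)\<^sup>2"
    by (rule derangement_char_factorization[OF assms(1)])
  let ?t = "s / derangement_sd n"
  have t: "\<bar>?t\<bar> \<le> pi"
    using s sd by (simp add: field_simps)
  have "norm (derangement_char n s) \<le> (\<Prod>i<m. exp (- (p i * (1 - p i)) * (?t\<^sup>2 / 18)))"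
    unfolding spec[OF fact] prod_norm[symmetric]
    using p t by (intro prod_mono conjI norm_ge_zero norm_centred_bernoulli_char_le) auto
  also have "\<dots> = exp (- (\<Sum>i<m. p i * (1 - p i)) * (?t\<^sup>2 / 18))"
    by (simp add: exp_sum[symmetric] sum_distrib_right sum_negf)
  also have "\<dots> = exp (- (s\<^sup>2 / 18))"
    unfolding var using sd by (simp add: power_divide)
  finally show ?thesis .
qed

lemma derangement_char_approx:
  assumes "n \<ge> 2" and sd: "derangement_sd n > 0"
  shows "norm (derangement_char n s - of_real (exp (- (s\<^sup>2 / 2))))
    \<le> \<bar>s\<bar> ^ 3 / (6 * derangement_sd n) + s ^ 4 / (8 * (derangement_sd n)\<^sup>2)"
proof -
  obtain m :: nat and p where p: "\<forall>i<m. 0 \<le> p i \<and> p i \<le> 1"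
    and fact: "\<forall>s. derangement_char n s = (\<Prod>i<m. centred_bernoulli_char (p i) (s / derangement_sd n))"
    and var: "(\<Sum>i<m. p i * (1 - p i)) = (derangement_sd n)\<^sup>2"
    by (rule derangement_char_factorization[OF assms(1)])
  let ?t = "s / derangement_sd n"
  let ?w = "\<lambda>i. complex_of_real (exp (- (p i * (1 - p i) * ?t\<^sup>2 / 2)))"
  have "(\<Sum>i<m. - (p i * (1 - p i) * ?t\<^sup>2 / 2)) = - ((\<Sum>i<m. p i * (1 - p i)) * ?t\<^sup>2 / 2)"
    by (simp only: sum_negf sum_distrib_right sum_divide_distrib)
  also have "\<dots> = - (s\<^sup>2 / 2)"
    unfolding var using sd by (simp add: power_divide)
  finally have "(\<Prod>i<m. ?w i) = of_real (exp (- (s\<^sup>2 / 2)))"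
    by (simp only: of_real_prod[symmetric] exp_sum[OF finite_lessThan, symmetric])
  then have "norm (derangement_char n s - of_real (exp (- (s\<^sup>2 / 2))))
      = norm ((\<Prod>i<m. centred_bernoulli_char (p i) ?t) - (\<Prod>i<m. ?w i))"
    by (simp only: spec[OF fact])
  \<comment> \<open>All factors have modulus at most 1, so the difference of the products is bounded
    by the sum of the differences.\<close>
  also have "\<dots> \<le> (\<Sum>i<m. norm (centred_bernoulli_char (p i) ?t - ?w i))"
    using p by (intro norm_prod_diff norm_centred_bernoulli_char_le_1) auto
  also have "\<dots> \<le> (\<Sum>i<m. p i * (1 - p i) * (\<bar>?t\<bar> ^ 3 / 6 + ?t ^ 4 / 8))"
    using p by (intro sum_mono centred_bernoulli_char_approx) auto
  also have "\<dots> = (derangement_sd n)\<^sup>2 * (\<bar>?t\<bar> ^ 3 / 6 + ?t ^ 4 / 8)"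
    by (simp only: sum_distrib_right[symmetric] var)
  also have "\<dots> = \<bar>s\<bar> ^ 3 / (6 * derangement_sd n) + s ^ 4 / (8 * (derangement_sd n)\<^sup>2)"
    using sd by (simp add: power_divide field_simps eval_nat_numeral)
  finally show ?thesis .
qed

section \<open>Fourier inversion and the local limit law\<close>

text \<open>Orthogonality over a full period: for nonzero \<open>m\<close> the antiderivative agrees
  at both ends, where the exponents differ by \<open>2 * pi * m\<close> times the imaginary
  unit.\<close>

lemma has_bochner_integral_iexp_period:
  fixes \<sigma> :: real and m :: int
  assumes "\<sigma> > 0"
  shows "has_bochner_integral lborel (\<lambda>s. indicator {- (pi * \<sigma>)..pi * \<sigma>} s *\<^sub>R iexp (s * (m / \<sigma>)))
    (if m = 0 then of_real (2 * pi * \<sigma>) else 0)"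
proof (cases "m = 0")
  case True
  have "has_bochner_integral lborel (\<lambda>s. indicator {- (pi * \<sigma>)..pi * \<sigma>} s *\<^sub>R (1::complex))
      (of_real (pi * \<sigma>) - of_real (- (pi * \<sigma>)))"
    using assms by (intro has_bochner_integral_FTC_Icc) (auto intro!: derivative_eq_intros)
  with True show ?thesis by (simp add: algebra_simps)
next
  case False
  let ?c = "\<i> * complex_of_real (m / \<sigma>)"
  let ?F = "\<lambda>s. exp (?c * complex_of_real s) / ?c"
  have c: "?c \<noteq> 0" using False assms by simp
  have eq: "iexp (s * (m / \<sigma>)) = exp (?c * complex_of_real s)" for s
    by (simp add: algebra_simps)
  have "has_bochner_integral lborel (\<lambda>s. indicator {- (pi * \<sigma>)..pi * \<sigma>} s *\<^sub>R iexp (s * (m / \<sigma>)))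
      (?F (pi * \<sigma>) - ?F (- (pi * \<sigma>)))"
  proof (rule has_bochner_integral_FTC_Icc)
    show "- (pi * \<sigma>) \<le> pi * \<sigma>" using assms by simp
    show "(?F has_vector_derivative iexp (s * (m / \<sigma>))) (at s within {- (pi * \<sigma>)..pi * \<sigma>})" for s
      unfolding eq
      by (rule has_vector_derivative_real_field[where f = "\<lambda>s. exp (?c * s) / ?c"])
         (use False assms in \<open>auto intro!: derivative_eq_intros\<close>)
  qed (use assms in \<open>auto intro!: continuous_intros\<close>)
  moreover have "?F (pi * \<sigma>) = ?F (- (pi * \<sigma>))"
  proof -
    have "exp (?c * complex_of_real (pi * \<sigma>)) = exp (?c * complex_of_real (- (pi * \<sigma>)))"
      unfolding exp_eq using assms by (intro exI[of _ m]) (simp add: field_simps)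
    then show ?thesis by simp
  qed
  ultimately show ?thesis
    using False by (simp only: diff_self if_False)
qed

text \<open>Expand \<open>derangement_char\<close> termwise: by orthogonality only derangements with
  exactly \<open>k\<close> excedances contribute, each
  \<open>2 * pi * derangement_sd n\<close>.\<close>

lemma derangement_eulerian_inversion:
  fixes n :: nat and k :: int
  defines "y \<equiv> (k - real n / 2) / derangement_sd n"
  assumes "n \<ge> 2" and sd: "derangement_sd n > 0"
  shows "has_bochner_integral lborel
    (\<lambda>s. indicator {- (pi * derangement_sd n)..pi * derangement_sd n} s *\<^sub>R (iexp (- (s * y)) * derangement_char n s))
    (of_real (2 * pi * (derangement_sd n * real (derangement_eulerian n k) / real (derangement_number n))))"
proof -
  let ?\<sigma> = "derangement_sd n" and ?D = "of_nat (derangement_number n) :: complex"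
  let ?I = "\<lambda>s. indicator {- (pi * ?\<sigma>)..pi * ?\<sigma>} s :: real"
  have "has_bochner_integral lborel
      (\<lambda>s. (\<Sum>p\<in>derangements n. ?I s *\<^sub>R iexp (s * (of_int (int (card (excedances n p)) - k) / ?\<sigma>))) / ?D)
      ((\<Sum>p\<in>derangements n. if int (card (excedances n p)) - k = 0 then of_real (2 * pi * ?\<sigma>) else 0) / ?D)"
    by (intro has_bochner_integral_divide_zero has_bochner_integral_sum has_bochner_integral_iexp_period sd)
  also have "(\<lambda>s. (\<Sum>p\<in>derangements n. ?I s *\<^sub>R iexp (s * (of_int (int (card (excedances n p)) - k) / ?\<sigma>))) / ?D)
      = (\<lambda>s. ?I s *\<^sub>R (iexp (- (s * y)) * derangement_char n s))"
  proof
    fix s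
    have "iexp (s * (of_int (int j - k) / ?\<sigma>)) = iexp (- (s * y)) * iexp (s * ((real j - real n / 2) / ?\<sigma>))" for j
    proof -
      have "s * (of_int (int j - k) / ?\<sigma>) = - (s * y) + s * ((real j - real n / 2) / ?\<sigma>)"
        unfolding y_def using sd by (simp add: field_simps)
      then show ?thesis
        by (simp only: of_real_add distrib_left exp_add)
    qed
    then show "(\<Sum>p\<in>derangements n. ?I s *\<^sub>R iexp (s * (of_int (int (card (excedances n p)) - k) / ?\<sigma>))) / ?D
        = ?I s *\<^sub>R (iexp (- (s * y)) * derangement_char n s)"
      by (simp only: derangement_char_def derangement_sum_def scaleR_conv_of_real
        sum_distrib_left[symmetric] times_divide_eq_right)
  qed
  also have "(\<Sum>p\<in>derangements n. if int (card (excedances n p)) - k = 0 then complex_of_real (2 * pi * ?\<sigma>) else 0) / ?D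
      = of_real (2 * pi * (?\<sigma> * real (derangement_eulerian n k) / real (derangement_number n)))"
  proof -
    have "(\<Sum>p\<in>derangements n. if int (card (excedances n p)) - k = 0 then complex_of_real (2 * pi * ?\<sigma>) else 0)
        = of_real (2 * pi * ?\<sigma> * real (derangement_eulerian n k))"
      by (simp add: derangement_eulerian_def sum.If_cases finite_derangements Int_def)
    then show ?thesis by simp
  qed
  finally show ?thesis .
qed

lemma has_bochner_integral_gaussian_fourier:
  "has_bochner_integral lborel (\<lambda>s. iexp (- (s * y)) * of_real (exp (- (s\<^sup>2 / 2))))
    (of_real (2 * pi * (1 / sqrt (2 * pi) * exp (- y\<^sup>2 / 2))))"
proof -
  have "char std_normal_distribution (- y) = (CLINT s|lborel. std_normal_density s *\<^sub>R iexp (- (s * y)))"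
    unfolding char_def by (subst integral_density) (auto simp: mult.commute)
  then have "(CLINT s|lborel. std_normal_density s *\<^sub>R iexp (- (s * y))) = of_real (exp (- y\<^sup>2 / 2))"
    by (simp add: char_std_normal_distribution)
  moreover have "integrable lborel (\<lambda>s. std_normal_density s *\<^sub>R iexp (- (s * y)))"
    by (rule Bochner_Integration.integrable_bound[OF integrable_normal_density[of 1 0]]) auto
  ultimately have "has_bochner_integral lborel (\<lambda>s. std_normal_density s *\<^sub>R iexp (- (s * y))) (of_real (exp (- y\<^sup>2 / 2)))"
    by (simp add: has_bochner_integral_iff)
  then have "has_bochner_integral lborel (\<lambda>s. complex_of_real (sqrt (2 * pi)) * (std_normal_density s *\<^sub>R iexp (- (s * y))))
      (complex_of_real (sqrt (2 * pi)) * of_real (exp (- y\<^sup>2 / 2)))"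
    by (rule has_bochner_integral_mult_right)
  moreover have "complex_of_real (sqrt (2 * pi)) * (std_normal_density s *\<^sub>R iexp (- (s * y)))
      = iexp (- (s * y)) * of_real (exp (- (s\<^sup>2 / 2)))" for s
    by (simp add: std_normal_density_def scaleR_conv_of_real)
  moreover have "sqrt (2 * pi) * exp (- y\<^sup>2 / 2) = 2 * pi * (1 / sqrt (2 * pi) * exp (- y\<^sup>2 / 2))"
    using real_sqrt_mult_self[of "2 * pi"] by (simp add: field_simps)
  ultimately show ?thesis
    by (simp only: of_real_mult[symmetric])
qed

text \<open>The indicator truncates only the first term, so the Gaussian tail outside the period
  counts as error and a single integral over the line measures everything.\<close>

definition char_error :: "nat \<Rightarrow> real \<Rightarrow> complex" where
  "char_error n s = indicator {- (pi * derangement_sd n)..pi * derangement_sd n} s *\<^sub>R derangement_char n s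
     - of_real (exp (- (s\<^sup>2 / 2)))"

lemma char_error_measurable [measurable]: "char_error n \<in> borel_measurable borel"
  unfolding char_error_def derangement_char_def derangement_sum_def by measurable

lemma norm_char_error_le:
  assumes "n \<ge> 2" and "derangement_sd n > 0"
  shows "norm (char_error n s) \<le> 2 * exp (- (s\<^sup>2 / 18))"
proof -
  have "norm (indicator {- (pi * derangement_sd n)..pi * derangement_sd n} s *\<^sub>R derangement_char n s) \<le> exp (- (s\<^sup>2 / 18))"
    using norm_derangement_char_le[OF assms, of s] by (auto simp: indicator_def abs_le_iff)
  moreover have "norm (complex_of_real (exp (- (s\<^sup>2 / 2)))) \<le> exp (- (s\<^sup>2 / 18))"
    by simp
  ultimately show ?thesis
    unfolding char_error_def by (intro norm_triangle_ineq4[THEN order_trans]) linarith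
qed

lemma integrable_gaussian_dominator: "integrable lborel (\<lambda>s::real. 2 * exp (- (s\<^sup>2 / 18)))"
proof -
  \<comment> \<open>The dominator is a multiple of a normal density of standard deviation 3, as
    \<open>18 = 2 * 3\<^sup>2\<close>.\<close>
  have "integrable lborel (\<lambda>s. 2 * sqrt (2 * pi * 9) * normal_density 0 3 s)"
    by (intro integrable_mult_right integrable_normal_density) simp
  then show ?thesis
    by (simp add: normal_density_def real_sqrt_mult)
qed

lemma integral_char_error_tendsto_0: "(\<lambda>n. \<integral>s. norm (char_error n s) \<partial>lborel) \<longlonglongrightarrow> 0"
proof -
  have ev: "\<forall>\<^sub>F n in sequentially. n \<ge> 2 \<and> derangement_sd n > 0"
    using eventually_ge_at_top[of 2] derangement_sd_at_top by (auto simp: filterlim_at_top_dense eventually_conj)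
  have pointwise: "(\<lambda>n. norm (char_error n s)) \<longlonglongrightarrow> 0" for s
  proof (rule Lim_null_comparison)
    have "\<forall>\<^sub>F n in sequentially. derangement_sd n > \<bar>s\<bar> / pi"
      using derangement_sd_at_top by (simp add: filterlim_at_top_dense)
    with ev show "\<forall>\<^sub>F n in sequentially. norm (norm (char_error n s))
        \<le> \<bar>s\<bar> ^ 3 / (6 * derangement_sd n) + s ^ 4 / (8 * (derangement_sd n)\<^sup>2)"
    proof eventually_elim
      case (elim n)
      \<comment> \<open>For fixed \<open>s\<close> the growing period eventually contains
        \<open>s\<close>, so the truncation disappears.\<close>
      then have "s \<in> {- (pi * derangement_sd n)..pi * derangement_sd n}"
        by (auto simp: field_simps abs_less_iff)
      with derangement_char_approx[of n s] elim show ?case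
        by (simp add: char_error_def)
    qed
    show "(\<lambda>n. \<bar>s\<bar> ^ 3 / (6 * derangement_sd n) + s ^ 4 / (8 * (derangement_sd n)\<^sup>2)) \<longlonglongrightarrow> 0"
      by (rule tendsto_eq_rhs[OF tendsto_add[OF filterlim_compose[OF _ derangement_sd_at_top]
            filterlim_compose[OF _ derangement_sd_at_top]]], real_asymp, real_asymp) simp
  qed
  \<comment> \<open>The domination holds only for large \<open>n\<close>, hence the shift of the
    sequence by \<open>N\<close>.\<close>
  obtain N where N: "\<And>n. n \<ge> N \<Longrightarrow> n \<ge> 2 \<and> derangement_sd n > 0"
    using ev by (auto simp: eventually_sequentially)
  have "(\<lambda>n. \<integral>s. norm (char_error (n + N) s) \<partial>lborel) \<longlonglongrightarrow> (\<integral>s. 0 \<partial>(lborel :: real measure))"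
  proof (rule integral_dominated_convergence[OF _ _ integrable_gaussian_dominator])
    show "AE s in lborel. (\<lambda>n. norm (char_error (n + N) s)) \<longlonglongrightarrow> 0"
      using LIMSEQ_ignore_initial_segment[OF pointwise] by auto
    show "AE s in lborel. norm (norm (char_error (n + N) s)) \<le> 2 * exp (- (s\<^sup>2 / 18))" for n
      using norm_char_error_le N[of "n + N"] by auto
  qed auto
  then show ?thesis
    by (simp add: LIMSEQ_offset)
qed

text \<open>Subtract the two inversion formulas. The point \<open>k\<close> enters only through a
  phase of modulus 1, so the bound is uniform in \<open>k\<close>; the factor
  \<open>2 * pi \<ge> 1\<close> is dropped.\<close>

lemma derangement_local_limit_at_lattice:
  assumes "n \<ge> 2" and sd: "derangement_sd n > 0"
  shows "\<bar>derangement_sd n * real (derangement_eulerian n k) / real (derangement_number n)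
      - 1 / sqrt (2 * pi) * exp (- ((k - real n / 2) / derangement_sd n)\<^sup>2 / 2)\<bar>
    \<le> (\<integral>s. norm (char_error n s) \<partial>lborel)"
proof -
  let ?y = "(k - real n / 2) / derangement_sd n"
  let ?a = "derangement_sd n * real (derangement_eulerian n k) / real (derangement_number n)"
  let ?b = "1 / sqrt (2 * pi) * exp (- ?y\<^sup>2 / 2)"
  have "has_bochner_integral lborel (\<lambda>s. iexp (- (s * ?y)) * char_error n s) (of_real (2 * pi * (?a - ?b)))"
    using has_bochner_integral_diff[OF derangement_eulerian_inversion[OF assms, of k] has_bochner_integral_gaussian_fourier[of ?y]]
    by (simp add: char_error_def algebra_simps)
  then have "norm (complex_of_real (2 * pi * (?a - ?b))) \<le> (\<integral>s. norm (iexp (- (s * ?y)) * char_error n s) \<partial>lborel)"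
    using integral_norm_bound[of lborel "\<lambda>s. iexp (- (s * ?y)) * char_error n s"] by (simp only: has_bochner_integral_integral_eq)
  also have "(\<integral>s. norm (iexp (- (s * ?y)) * char_error n s) \<partial>lborel) = (\<integral>s. norm (char_error n s) \<partial>lborel)"
    by (simp add: norm_mult)
  also have "norm (complex_of_real (2 * pi * (?a - ?b))) = 2 * pi * \<bar>?a - ?b\<bar>"
    unfolding norm_of_real by (simp add: abs_mult)
  finally have "2 * pi * \<bar>?a - ?b\<bar> \<le> (\<integral>s. norm (char_error n s) \<partial>lborel)" .
  moreover have "1 * \<bar>?a - ?b\<bar> \<le> 2 * pi * \<bar>?a - ?b\<bar>"
    using pi_gt3 by (intro mult_right_mono) auto
  ultimately show ?thesis
    unfolding mult_1 by (rule order_trans[rotated])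
qed

text \<open>The derivative is bounded by 1 since \<open>\<bar>z\<bar> \<le> 1 + z\<^sup>2 / 2 \<le>
  exp (z\<^sup>2 / 2)\<close>. This pays for replacing \<open>x\<close> by a nearby lattice
  point.\<close>

lemma gaussian_lipschitz:
  "\<bar>exp (- x\<^sup>2 / 2) - exp (- y\<^sup>2 / 2)\<bar> \<le> \<bar>x - y\<bar>" for x y :: real
proof -
  have "norm (exp (- x\<^sup>2 / 2) - exp (- y\<^sup>2 / 2)) \<le> 1 * norm (x - y)"
  proof (rule field_differentiable_bound[OF convex_UNIV])
    show "((\<lambda>x. exp (- x\<^sup>2 / 2)) has_field_derivative exp (- z\<^sup>2 / 2) * (- z)) (at z within UNIV)" for z :: real
      by (auto intro!: derivative_eq_intros)
    show "norm (exp (- z\<^sup>2 / 2) * (- z)) \<le> 1" for z :: real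
    proof -
      have "0 \<le> (\<bar>z\<bar> - 1)\<^sup>2" by simp
      then have "\<bar>z\<bar> \<le> 1 + z\<^sup>2 / 2" by (simp add: power2_eq_square algebra_simps)
      also have "\<dots> \<le> exp (z\<^sup>2 / 2)" by (rule exp_ge_add_one_self)
      finally show ?thesis by (simp add: abs_mult exp_minus field_simps)
    qed
  qed auto
  then show ?thesis by simp
qed

theorem theorem7p4:
  shows "(\<forall>n\<ge>2. derangement_mean n = real n / 2) \<and>
    (\<lambda>n. (derangement_sd n)\<^sup>2) \<sim>[at_top] (\<lambda>n. real n / 12) \<and>
    uniform_limit UNIV
      (\<lambda>n x. derangement_sd n * real (derangement_eulerian n (derangement_index n x))
             / real (derangement_number n))
      (\<lambda>x. 1 / sqrt (2 * pi) * exp (- x\<^sup>2 / 2))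
      sequentially"
proof (intro conjI allI impI)
  let ?\<sigma> = derangement_sd
  let ?f = "\<lambda>n x. ?\<sigma> n * real (derangement_eulerian n (derangement_index n x)) / real (derangement_number n)"
  let ?g = "\<lambda>x. 1 / sqrt (2 * pi) * exp (- x\<^sup>2 / 2)"
  \<comment> \<open>The first summand is the Fourier error at the lattice point, the second the cost
    of rounding; neither depends on \<open>x\<close>.\<close>
  let ?e = "\<lambda>n. (\<integral>s. norm (char_error n s) \<partial>lborel) + 1 / ?\<sigma> n"
  have bound: "dist (?f n x) (?g x) \<le> ?e n" if "n \<ge> 2" "?\<sigma> n > 0" for n x
  proof -
    let ?y = "(derangement_index n x - real n / 2) / ?\<sigma> n"
    \<comment> \<open>The floor moves its argument by less than 1, that is, by at most
      \<open>1 / ?\<sigma> n\<close> after standardization.\<close>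
    have "of_int (derangement_index n x) \<le> real n / 2 + x * ?\<sigma> n"
      "real n / 2 + x * ?\<sigma> n < of_int (derangement_index n x) + 1"
      unfolding derangement_index_def by linarith+
    then have "\<bar>(derangement_index n x - real n / 2) - x * ?\<sigma> n\<bar> \<le> 1"
      by linarith
    moreover have "?y - x = ((derangement_index n x - real n / 2) - x * ?\<sigma> n) / ?\<sigma> n"
      using that(2) by (simp add: diff_divide_distrib)
    ultimately have "\<bar>?y - x\<bar> \<le> 1 / ?\<sigma> n"
      using that(2) by (simp only: abs_divide abs_of_pos divide_right_mono less_imp_le)
    moreover have "\<bar>?g ?y - ?g x\<bar> \<le> \<bar>?y - x\<bar>"
    proof -
      have "1 / sqrt (2 * pi) \<le> 1" using pi_gt3 by simp
      then have "1 / sqrt (2 * pi) * \<bar>exp (- ?y\<^sup>2 / 2) - exp (- x\<^sup>2 / 2)\<bar> \<le> 1 * \<bar>?y - x\<bar>"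
        by (intro mult_mono gaussian_lipschitz) auto
      then show ?thesis
        by (simp only: right_diff_distrib[symmetric] abs_mult) simp
    qed
    ultimately show ?thesis
      using derangement_local_limit_at_lattice[OF that, of "derangement_index n x"]
      unfolding dist_real_def by linarith
  qed
  have "?e \<longlonglongrightarrow> 0 + 0"
    using tendsto_inverse_0_at_top[OF derangement_sd_at_top]
    by (intro tendsto_add integral_char_error_tendsto_0) (simp add: inverse_eq_divide)
  show "uniform_limit UNIV ?f ?g sequentially"
  proof (rule uniform_limitI)
    fix e :: real assume "e > 0"
    with \<open>?e \<longlonglongrightarrow> 0 + 0\<close> have "\<forall>\<^sub>F n in sequentially. ?e n < e"
      by (intro order_tendstoD) auto
    moreover have "\<forall>\<^sub>F n in sequentially. ?\<sigma> n > 0"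
      using derangement_sd_at_top by (simp add: filterlim_at_top_dense)
    ultimately show "\<forall>\<^sub>F n in sequentially. \<forall>x\<in>UNIV. dist (?f n x) (?g x) < e"
      using eventually_ge_at_top[of 2]
      by eventually_elim (use bound in \<open>blast intro: le_less_trans\<close>)
  qed
qed (simp_all add: derangement_mean_eq derangement_variance_asymp)

end
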